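(* Assume that $a$ and $b_i$, $i=1,\ldots,m$, are non-positive integers and that $c$ is a positive integer; write $b=(b_1,\ldots,b_m)$. The image of the map $$z\mapsto\left(z_1\frac{\partial F_D(a,b,c;z)}{\partial z_1}/F_D(a,b,c;z),\ \ldots,\ z_m\frac{\partial F_D(a,b,c;z)}{\partial z_m}/F_D(a,b,c;z)\right)$$ for $z\in\mathbb{R}_{>0}^m$ is the relative interior of the polytope defined by $$\{\eta\in\mathbb{R}^m\ |\ \eta_1+\cdots+\eta_m\le -a,\ \eta_i\le -b_i\text{ and }\eta_i\ge 0\text{ for }i=1,\ldots,m\},$$ and the map is one-to-one.
   Context: The Lauricella function $F_D$ is defined by $$F_D(a,b,c;z_1,\ldots,z_m)=\sum_{k\in\mathbb{N}^m}\frac{(a)_{|k|}(b_1)_{k_1}\cdots(b_m)_{k_m}}{(c)_{|k|}(1)_{k_1}\cdots(1)_{k_m}}z^k,$$ where $\mathbb{N}$ is the set of non-negative integers, $a$, $b=(b_1,\ldots,b_m)$ and $c$ are numbers, $z=(z_1,\ldots,z_m)$, $|k|=k_1+\cdots+k_m$, $z^k=\prod_{i=1}^m z_i^{k_i}$, and $(\alpha)_i=\alpha(\alpha+1)\cdots(\alpha+i-1)$ (with $(\alpha)_0=1$) is the Pochhammer symbol. For non-positive integers $a,b_1,\ldots,b_m$ and a positive integer $c$ it is a polynomial in $z$.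
   Formalization: The map is stated to be one-to-one exactly when a and all b_i are nonzero: if a = 0 the map is constantly 0, and if some b_i = 0 it does not depend on z_i, so injectivity fails in those cases. The image claim is kept in full. *)

theory Defs
  imports "HOL-Analysis.Analysis"
begin

text \<open>
  Multi-indices are vectors \<open>k :: nat ^ 'n\<close> with \<open>m = CARD('n)\<close>. The series is an unconditional sum
  over all of them; it has only finitely many nonzero terms if, for example, \<open>a\<close> is a
  non-positive integer. If \<open>c\<close> is a non-positive integer, the convention \<open>x / 0 = 0\<close>
  makes the value meaningless.
\<close>

definition lauricella_FD ::
    "'a::real_normed_field \<Rightarrow> 'a ^ 'n \<Rightarrow> 'a \<Rightarrow> 'a ^ 'n \<Rightarrow> 'a" where
  "lauricella_FD a b c z =
     (\<Sum>\<^sub>\<infinity>k\<in>(UNIV :: (nat ^ 'n) set).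
        (pochhammer a (\<Sum>i\<in>UNIV. k $ i) * (\<Prod>i\<in>UNIV. pochhammer (b $ i) (k $ i))) /
        (pochhammer c (\<Sum>i\<in>UNIV. k $ i) * (\<Prod>i\<in>UNIV. pochhammer 1 (k $ i))) *
        (\<Prod>i\<in>UNIV. z $ i ^ (k $ i)))"

definition partial_deriv ::
    "'n \<Rightarrow> ('a::real_normed_field ^ 'n \<Rightarrow> 'a) \<Rightarrow> 'a ^ 'n \<Rightarrow> 'a" where
  "partial_deriv i f z = deriv (\<lambda>t. f (\<chi> j. if j = i then t else z $ j)) (z $ i)"

definition FD_map :: "real \<Rightarrow> real ^ 'n \<Rightarrow> real \<Rightarrow> real ^ 'n \<Rightarrow> real ^ 'n" where
  "FD_map a b c z =
     (\<chi> i. z $ i * partial_deriv i (lauricella_FD a b c) z / lauricella_FD a b c z)"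

definition FD_polytope :: "real \<Rightarrow> real ^ 'n \<Rightarrow> (real ^ 'n) set" where
  "FD_polytope a b =
     {\<eta>. (\<Sum>i\<in>UNIV. \<eta> $ i) \<le> - a \<and> (\<forall>i. \<eta> $ i \<le> - (b $ i) \<and> \<eta> $ i \<ge> 0)}"

end

theory Submission imports Defs begin

text \<open>
  For \<open>a = - N\<close> and \<open>b = - n\<close> the series is a polynomial. Its exponents \<open>k\<close> are the lattice points
  of the polytope \<open>P = FD_polytope a b\<close>, and its coefficients are positive, because in the
  numerator the Pochhammer symbol of \<open>a\<close> and the product of those of the \<open>b\<^sub>i\<close> both have the sign
  \<open>(-1) ^ (\<Sum>i. k\<^sub>i)\<close>. In logarithmic coordinates
  \<open>z\<^sub>i = exp x\<^sub>i\<close> the monomial \<open>z\<^sup>k\<close> becomes \<open>exp (k \<bullet> x)\<close>, and the map of the theorem becomes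
  \<open>x \<mapsto> (\<Sum>k. w\<^sub>k exp (k \<bullet> x) k) / (\<Sum>k. w\<^sub>k exp (k \<bullet> x))\<close>, the moment map of a finite configuration of
  points with positive weights: it is the gradient of \<open>ln (\<Sum>k. w\<^sub>k exp (k \<bullet> x))\<close>.

  The image of a moment map is the relative interior of the convex hull of the configuration
  (\<open>range_moment_map\<close>). Its values are convex combinations with positive coefficients, and these
  make up the relative interior. Conversely, a point \<open>\<eta>\<close> of the relative interior is the value at a
  minimiser of \<open>\<Sum>k. w\<^sub>k exp ((k - \<eta>) \<bullet> x)\<close>, which exists by \<open>balanced_exp_sum_critical_point\<close>.
  It remains to see that \<open>P\<close> is the convex hull of its lattice points
  (\<open>FD_polytope_eq_convex_hull\<close>), that is, that its extreme points are integral.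

  If two points \<open>x\<close>, \<open>y\<close> have the same value under the moment map, then a relative entropy argument
  (\<open>moment_map_eqD\<close>) shows that \<open>k \<bullet> (y - x)\<close> is the same for all points \<open>k\<close> of the configuration.
  If \<open>N\<close> and all \<open>n\<^sub>i\<close> are positive, then \<open>0\<close> and all unit vectors belong to the configuration,
  which forces \<open>x = y\<close>. Otherwise some coordinate vanishes on the whole configuration, and
  the map does not depend on that coordinate of \<open>x\<close>.
\<close>

section \<open>Moment maps of finite point configurations\<close>

definition moment_map :: "'i set \<Rightarrow> ('i \<Rightarrow> real) \<Rightarrow> ('i \<Rightarrow> 'a) \<Rightarrow> 'a \<Rightarrow> 'a::euclidean_space" where
  "moment_map I w p x =
     (\<Sum>i\<in>I. (w i * exp (p i \<bullet> x)) *\<^sub>R p i) /\<^sub>R (\<Sum>i\<in>I. w i * exp (p i \<bullet> x))"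

lemma exp_sum_pos:
  fixes p :: "'i \<Rightarrow> 'a::euclidean_space"
  assumes "finite I" "I \<noteq> {}" "\<And>i. i \<in> I \<Longrightarrow> w i > 0"
  shows "(\<Sum>i\<in>I. w i * exp (p i \<bullet> x)) > 0"
  using assms by (intro sum_pos) auto

text \<open>
  Balance means that \<open>0\<close> is a positive combination of the \<open>p i\<close>, so moving far along their span
  \<open>L\<close> in any direction makes some \<open>p i \<bullet> x\<close> large: the function
  \<open>f x = (\<Sum>i\<in>I. w i * exp (p i \<bullet> x))\<close> is coercive on \<open>L\<close> and has a minimiser there. The sum in the
  conclusion is the gradient of \<open>f\<close>; it lies in \<open>L\<close>, so it is a direction in which the minimiser is
  critical, and hence orthogonal to itself.
\<close>

lemma balanced_exp_sum_critical_point: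
  fixes p :: "'i \<Rightarrow> 'a::euclidean_space"
  assumes fin: "finite I"
    and w: "\<And>i. i \<in> I \<Longrightarrow> w i > 0"
    and c: "\<And>i. i \<in> I \<Longrightarrow> c i > 0"
    and balanced: "(\<Sum>i\<in>I. c i *\<^sub>R p i) = 0"
  obtains x where "(\<Sum>i\<in>I. (w i * exp (p i \<bullet> x)) *\<^sub>R p i) = 0"
proof -
  define L where "L = span (p ` I)"
  define f where "f x = (\<Sum>i\<in>I. w i * exp (p i \<bullet> x))" for x
  \<comment> \<open>\<open>T\<close> is injective on \<open>L\<close>, so bounds on all the products \<open>p i \<bullet> x\<close> bound \<open>x \<in> L\<close>.\<close>
  define T where "T x = (\<Sum>i\<in>I. (p i \<bullet> x) *\<^sub>R p i)" for x
  have linT: "linear T"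
    unfolding T_def
    by (intro linearI) (simp_all add: inner_right_distrib scaleR_left_distrib sum.distrib scaleR_sum_right)
  have inj: "x = 0" if x: "x \<in> L" and "T x = 0" for x
  proof -
    have "0 = x \<bullet> T x" using that by simp
    also have "\<dots> = (\<Sum>i\<in>I. (p i \<bullet> x)\<^sup>2)"
      by (simp add: T_def inner_sum_right power2_eq_square inner_commute)
    finally have "\<forall>i\<in>I. (p i \<bullet> x)\<^sup>2 = 0"
      using fin by (metis (no_types, lifting) sum_nonneg_eq_0_iff zero_le_power2)
    then have perp: "orthogonal x y" if "y \<in> p ` I" for y
      using that by (auto simp: orthogonal_def inner_commute)
    have "orthogonal x x"
      by (rule orthogonal_to_span[OF x[unfolded L_def] perp])
    then show ?thesis by (simp add: orthogonal_self)
  qed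
  have "\<exists>e>0. \<forall>x\<in>L. norm (T x) \<ge> e * norm x"
    using inj linT unfolding L_def
    by (intro injective_imp_isometric closed_subspace subspace_span) (auto simp: linear_linear)
  then obtain e where e: "e > 0" "\<And>x. x \<in> L \<Longrightarrow> e * norm x \<le> norm (T x)"
    by blast
  define S where "S = {x \<in> L. f x \<le> f 0}"
  define M where "M i = f 0 / w i" for i
  define C where "C = (\<Sum>i\<in>I. c i * M i)"
  have M0: "M i \<ge> 0" if "i \<in> I" for i
    unfolding M_def f_def using w that less_imp_le by (intro divide_nonneg_pos sum_nonneg) auto
  have upper: "p i \<bullet> x \<le> M i" if "x \<in> S" "i \<in> I" for i x
  proof -
    have "w i * exp (p i \<bullet> x) \<le> f x"
      unfolding f_def using fin w that
      by (intro member_le_sum) (auto simp: less_imp_le)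
    also have "\<dots> \<le> f 0" using that by (simp add: S_def)
    finally have "exp (p i \<bullet> x) \<le> M i"
      using w[OF \<open>i \<in> I\<close>] by (simp add: M_def field_simps)
    then show ?thesis using exp_ge_add_one_self[of "p i \<bullet> x"] by linarith
  qed
  \<comment> \<open>By balance, the upper bounds for the other products bound each product from below.\<close>
  have lower: "- (C / c i) \<le> p i \<bullet> x" if "x \<in> S" "i \<in> I" for i x
  proof -
    have "(\<Sum>j\<in>I. c j * (p j \<bullet> x)) = (\<Sum>j\<in>I. c j *\<^sub>R p j) \<bullet> x"
      by (simp add: inner_sum_left)
    then have "0 = (\<Sum>j\<in>I. c j * (p j \<bullet> x))"
      using balanced by simp
    also have "\<dots> = c i * (p i \<bullet> x) + (\<Sum>j\<in>I - {i}. c j * (p j \<bullet> x))"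
      using fin that by (simp add: sum.remove)
    also have "\<dots> \<le> c i * (p i \<bullet> x) + (\<Sum>j\<in>I - {i}. c j * M j)"
      using upper[OF \<open>x \<in> S\<close>] c by (intro add_left_mono sum_mono mult_left_mono) (auto simp: less_imp_le)
    also have "\<dots> \<le> c i * (p i \<bullet> x) + C"
      unfolding C_def using fin M0 c by (intro add_left_mono sum_mono2) (auto simp: less_imp_le)
    finally show ?thesis using c[OF \<open>i \<in> I\<close>] by (simp add: field_simps)
  qed
  have "norm x \<le> (\<Sum>i\<in>I. (M i + \<bar>C / c i\<bar>) * norm (p i)) / e" if "x \<in> S" for x
  proof -
    have "e * norm x \<le> norm (T x)" using e that by (simp add: S_def)
    also have "\<dots> \<le> (\<Sum>i\<in>I. \<bar>p i \<bullet> x\<bar> * norm (p i))"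
      unfolding T_def using norm_sum[of "\<lambda>i. (p i \<bullet> x) *\<^sub>R p i" I] by simp
    also have "\<dots> \<le> (\<Sum>i\<in>I. (M i + \<bar>C / c i\<bar>) * norm (p i))"
    proof (intro sum_mono mult_right_mono)
      fix i assume "i \<in> I"
      then show "\<bar>p i \<bullet> x\<bar> \<le> M i + \<bar>C / c i\<bar>"
        using upper[OF that] lower[OF that] M0 by (smt (verit))
    qed auto
    finally show ?thesis using e by (simp add: field_simps)
  qed
  then have "bounded S" by (auto simp: bounded_iff)
  have cont: "continuous_on A f" for A
    unfolding f_def by (intro continuous_intros)
  have "closed S"
  proof -
    have "closed {x. f x \<le> f 0}"
      using cont[of UNIV] by (intro closed_Collect_le) (auto intro: continuous_on_const)
    moreover have "S = L \<inter> {x. f x \<le> f 0}" by (auto simp: S_def)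
    ultimately show ?thesis by (simp add: L_def closed_Int closed_subspace subspace_span)
  qed
  moreover have "0 \<in> S" by (simp add: S_def L_def span_zero)
  ultimately obtain x where x: "x \<in> S" "\<And>y. y \<in> S \<Longrightarrow> f x \<le> f y"
    using continuous_attains_inf[of S f] \<open>bounded S\<close> cont
    by (metis compact_eq_bounded_closed empty_iff)
  have minL: "f x \<le> f y" if "y \<in> L" for y
  proof (cases "y \<in> S")
    case False
    then have "f 0 < f y" using that by (simp add: S_def)
    moreover have "f x \<le> f 0" using x(1) by (simp add: S_def)
    ultimately show ?thesis by linarith
  qed (rule x(2))
  define v where "v = (\<Sum>i\<in>I. (w i * exp (p i \<bullet> x)) *\<^sub>R p i)"
  have "v \<in> L" unfolding v_def L_def
    by (intro span_sum span_scale span_base) auto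
  have "((\<lambda>t. f (x + t *\<^sub>R v)) has_real_derivative v \<bullet> v) (at 0)"
  proof -
    have "((\<lambda>t. f (x + t *\<^sub>R v)) has_real_derivative
            (\<Sum>i\<in>I. w i * (exp (p i \<bullet> x) * (p i \<bullet> v)))) (at 0)"
      unfolding f_def inner_add_right inner_scaleR_right
      by (rule DERIV_sum) (auto intro!: derivative_eq_intros)
    also have "(\<Sum>i\<in>I. w i * (exp (p i \<bullet> x) * (p i \<bullet> v))) = v \<bullet> v"
      by (subst (2) v_def) (simp add: inner_sum_left mult.assoc)
    finally show ?thesis .
  qed
  moreover have "\<forall>t. \<bar>0 - t\<bar> < 1 \<longrightarrow> f (x + 0 *\<^sub>R v) \<le> f (x + t *\<^sub>R v)"
    using \<open>v \<in> L\<close> x(1) by (auto simp: S_def L_def intro!: minL[unfolded L_def] span_add span_scale)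
  ultimately have "v \<bullet> v = 0"
    by (intro DERIV_local_min[of "\<lambda>t. f (x + t *\<^sub>R v)" "v \<bullet> v" 0 1]) auto
  then show ?thesis using that[of x] by (simp add: v_def)
qed

lemma rel_interior_convex_hull_image:
  fixes p :: "'i \<Rightarrow> 'a::euclidean_space"
  assumes "finite I"
  shows "rel_interior (convex hull (p ` I)) =
           {(\<Sum>i\<in>I. c i *\<^sub>R p i) | c. (\<forall>i\<in>I. c i > 0) \<and> sum c I = 1}"
proof -
  have eq: "(\<Union>i\<in>I. {p i}) = p ` I" by auto
  have "rel_interior (convex hull (p ` I)) =
      {sum (\<lambda>i. c i *\<^sub>R s i) I | c s. (\<forall>i\<in>I. c i > 0) \<and> sum c I = 1 \<and> (\<forall>i\<in>I. s i \<in> {p i})}"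
    using rel_interior_convex_hull_union[of I "\<lambda>i. {p i}"] assms by (simp add: eq)
  also have "\<dots> = {(\<Sum>i\<in>I. c i *\<^sub>R p i) | c. (\<forall>i\<in>I. c i > 0) \<and> sum c I = 1}"
  proof (intro equalityI subsetI)
    fix x assume "x \<in> {sum (\<lambda>i. c i *\<^sub>R s i) I | c s.
      (\<forall>i\<in>I. c i > 0) \<and> sum c I = 1 \<and> (\<forall>i\<in>I. s i \<in> {p i})}"
    then obtain c s where cs: "\<forall>i\<in>I. c i > 0" "sum c I = 1" "\<forall>i\<in>I. s i \<in> {p i}"
      "x = (\<Sum>i\<in>I. c i *\<^sub>R s i)" by blast
    have "x = (\<Sum>i\<in>I. c i *\<^sub>R p i)"
      unfolding cs(4) using cs(3) by (intro sum.cong) auto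
    then show "x \<in> {(\<Sum>i\<in>I. c i *\<^sub>R p i) | c. (\<forall>i\<in>I. c i > 0) \<and> sum c I = 1}"
      using cs(1,2) by (intro CollectI exI[of _ c]) blast
  next
    fix x assume "x \<in> {(\<Sum>i\<in>I. c i *\<^sub>R p i) | c. (\<forall>i\<in>I. c i > 0) \<and> sum c I = 1}"
    then obtain c where "\<forall>i\<in>I. c i > 0" "sum c I = 1" "x = (\<Sum>i\<in>I. c i *\<^sub>R p i)" by blast
    then show "x \<in> {sum (\<lambda>i. c i *\<^sub>R s i) I | c s.
      (\<forall>i\<in>I. c i > 0) \<and> sum c I = 1 \<and> (\<forall>i\<in>I. s i \<in> {p i})}"
      by (intro CollectI exI[of _ c] exI[of _ p]) simp
  qed
  finally show ?thesis .
qed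

text \<open>
  Translating the configuration by \<open>- \<eta>\<close> multiplies the exponential sum by \<open>exp (- \<eta> \<bullet> x)\<close>, and the
  value at \<open>x\<close> is \<open>\<eta>\<close> exactly if \<open>x\<close> is a critical point of the translated sum. That
  \<open>\<eta>\<close> lies in the relative interior says that the translated configuration is balanced.
\<close>

theorem range_moment_map:
  fixes p :: "'i \<Rightarrow> 'a::euclidean_space"
  assumes fin: "finite I" and ne: "I \<noteq> {}" and w: "\<And>i. i \<in> I \<Longrightarrow> w i > 0"
  shows "range (moment_map I w p) = rel_interior (convex hull (p ` I))"
proof (intro equalityI subsetI)
  fix \<eta> assume "\<eta> \<in> range (moment_map I w p)"
  then obtain x where x: "\<eta> = moment_map I w p x" by auto
  define Z where "Z = (\<Sum>i\<in>I. w i * exp (p i \<bullet> x))"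
  have Z: "Z > 0" unfolding Z_def by (intro exp_sum_pos assms)
  have "\<eta> = (\<Sum>i\<in>I. (w i * exp (p i \<bullet> x) / Z) *\<^sub>R p i)"
    by (simp add: x moment_map_def Z_def[symmetric] scaleR_sum_right divide_inverse_commute)
  moreover have "(\<Sum>i\<in>I. w i * exp (p i \<bullet> x) / Z) = 1"
    using Z by (simp add: sum_divide_distrib[symmetric] Z_def[symmetric])
  moreover have "\<forall>i\<in>I. w i * exp (p i \<bullet> x) / Z > 0" using w Z by simp
  ultimately show "\<eta> \<in> rel_interior (convex hull (p ` I))"
    unfolding rel_interior_convex_hull_image[OF fin]
    by (intro CollectI exI[of _ "\<lambda>i. w i * exp (p i \<bullet> x) / Z"]) blast
next
  fix \<eta> assume "\<eta> \<in> rel_interior (convex hull (p ` I))"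
  then obtain c where c: "\<forall>i\<in>I. c i > 0" "sum c I = 1" "\<eta> = (\<Sum>i\<in>I. c i *\<^sub>R p i)"
    unfolding rel_interior_convex_hull_image[OF fin] by blast
  have "(\<Sum>i\<in>I. c i *\<^sub>R (p i - \<eta>)) = 0"
    using c by (simp add: scaleR_diff_right sum_subtractf flip: scaleR_sum_left)
  then obtain x where x: "(\<Sum>i\<in>I. (w i * exp ((p i - \<eta>) \<bullet> x)) *\<^sub>R (p i - \<eta>)) = 0"
    using balanced_exp_sum_critical_point[of I w c "\<lambda>i. p i - \<eta>"] fin w c(1) by metis
  define Z where "Z = (\<Sum>i\<in>I. w i * exp (p i \<bullet> x))"
  have Z: "Z > 0" unfolding Z_def by (intro exp_sum_pos assms)
  have "0 = exp (\<eta> \<bullet> x) *\<^sub>R (\<Sum>i\<in>I. (w i * exp ((p i - \<eta>) \<bullet> x)) *\<^sub>R (p i - \<eta>))"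
    using x by simp
  also have "\<dots> = (\<Sum>i\<in>I. (w i * exp (p i \<bullet> x)) *\<^sub>R (p i - \<eta>))"
    by (simp add: scaleR_sum_right inner_diff_left exp_diff)
  also have "\<dots> = (\<Sum>i\<in>I. (w i * exp (p i \<bullet> x)) *\<^sub>R p i) - Z *\<^sub>R \<eta>"
    by (simp add: scaleR_diff_right sum_subtractf Z_def flip: scaleR_sum_left)
  finally have "\<eta> = moment_map I w p x"
    using Z by (simp add: moment_map_def Z_def[symmetric])
  then show "\<eta> \<in> range (moment_map I w p)" by blast
qed

text \<open>
  Let \<open>q x\<close> be the probability vector proportional to \<open>w i * exp (p i \<bullet> x)\<close>, so that the moment map is
  the mean of \<open>p\<close> under \<open>q x\<close>. The symmetrised relative entropy
  \<open>\<Sum>i\<in>I. (q y i - q x i) * (ln (q y i) - ln (q x i))\<close> equals the inner product of the difference of the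
  means with \<open>y - x\<close>. For equal means it is zero; as \<open>ln\<close> is strictly increasing, this forces
  \<open>q x = q y\<close>, and then \<open>p i \<bullet> (y - x)\<close> is the logarithm of the ratio of the normalising factors.
\<close>

lemma moment_map_eqD:
  fixes p :: "'i \<Rightarrow> 'a::euclidean_space"
  assumes fin: "finite I" and w: "\<And>i. i \<in> I \<Longrightarrow> w i > 0"
    and eq: "moment_map I w p x = moment_map I w p y"
    and i: "i \<in> I" and j: "j \<in> I"
  shows "p i \<bullet> (y - x) = p j \<bullet> (y - x)"
proof -
  define Z where "Z x = (\<Sum>i\<in>I. w i * exp (p i \<bullet> x))" for x
  have Z: "Z x > 0" for x
    unfolding Z_def using i by (intro exp_sum_pos fin w) auto
  define q where "q x i = w i * exp (p i \<bullet> x) / Z x" for x i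
  have q: "q x i > 0" if "i \<in> I" for x i using that w Z by (simp add: q_def)
  have mm: "moment_map I w p x = (\<Sum>i\<in>I. q x i *\<^sub>R p i)" for x
    by (simp add: moment_map_def Z_def[symmetric] q_def scaleR_sum_right divide_inverse_commute)
  have q1: "(\<Sum>i\<in>I. q x i) = 1" for x
    using Z[of x] by (simp add: q_def sum_divide_distrib[symmetric] Z_def[symmetric])
  have lnq: "ln (q y i) - ln (q x i) = p i \<bullet> (y - x) - (ln (Z y) - ln (Z x))" if "i \<in> I" for i
    using w[OF that] Z[of x] Z[of y] by (simp add: q_def ln_div ln_mult inner_diff_right)
  have "(\<Sum>i\<in>I. (q y i - q x i) * (ln (q y i) - ln (q x i)))
      = (\<Sum>i\<in>I. (q y i - q x i) * (p i \<bullet> (y - x)) - (q y i - q x i) * (ln (Z y) - ln (Z x)))"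
    by (intro sum.cong refl) (simp only: lnq right_diff_distrib)
  also have "\<dots> = (\<Sum>i\<in>I. (q y i - q x i) * (p i \<bullet> (y - x)))
      - (\<Sum>i\<in>I. q y i - q x i) * (ln (Z y) - ln (Z x))"
    by (simp only: sum_subtractf[of "\<lambda>i. (q y i - q x i) * (p i \<bullet> (y - x))"] sum_distrib_right)
  also have "(\<Sum>i\<in>I. q y i - q x i) = 0" by (simp add: sum_subtractf q1)
  also have "(\<Sum>i\<in>I. (q y i - q x i) * (p i \<bullet> (y - x)))
      = (moment_map I w p y - moment_map I w p x) \<bullet> (y - x)"
    by (simp add: mm inner_sum_left inner_diff_left left_diff_distrib sum_subtractf)
  finally have s0: "(\<Sum>i\<in>I. (q y i - q x i) * (ln (q y i) - ln (q x i))) = 0"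
    using eq by simp
  have "(q y i - q x i) * (ln (q y i) - ln (q x i)) \<ge> 0" if "i \<in> I" for i
    using q[OF that, of x] q[OF that, of y]
    by (cases "q x i \<le> q y i") (simp_all add: mult_nonpos_nonpos)
  then have "\<forall>i\<in>I. (q y i - q x i) * (ln (q y i) - ln (q x i)) = 0"
    using s0 fin by (simp add: sum_nonneg_eq_0_iff)
  then have "\<forall>i\<in>I. ln (q y i) - ln (q x i) = 0"
    by auto
  then show ?thesis using lnq[OF i] lnq[OF j] i j by auto
qed

section \<open>Integrality of the polytope\<close>

definition lattice_points :: "nat \<Rightarrow> nat ^ 'n \<Rightarrow> (nat ^ 'n) set" where
  "lattice_points N n = {k. (\<Sum>i\<in>UNIV. k $ i) \<le> N \<and> (\<forall>i. k $ i \<le> n $ i)}"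

definition real_vec :: "nat ^ 'n \<Rightarrow> real ^ 'n" where
  "real_vec k = (\<chi> i. real (k $ i))"

lemma finite_lattice_points: "finite (lattice_points N n)"
proof -
  have "lattice_points N n \<subseteq> vec_lambda ` (PiE UNIV (\<lambda>i. {..n $ i}))"
  proof
    fix k assume "k \<in> lattice_points N n"
    then have "vec_nth k \<in> PiE UNIV (\<lambda>i. {..n $ i})" by (auto simp: lattice_points_def)
    then show "k \<in> vec_lambda ` (PiE UNIV (\<lambda>i. {..n $ i}))"
      by (metis image_eqI vec_nth_inverse)
  qed
  then show ?thesis by (rule finite_subset) (intro finite_imageI finite_PiE, auto)
qed

lemma real_vec_in_FD_polytope_iff:
  "real_vec k \<in> FD_polytope (- real N) (- real_vec n) \<longleftrightarrow> k \<in> lattice_points N n"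
  by (simp add: FD_polytope_def real_vec_def lattice_points_def flip: of_nat_sum)

lemma compact_FD_polytope: "compact (FD_polytope a b)"
proof -
  have "FD_polytope a b = {\<eta>. (\<Sum>i\<in>UNIV. \<eta> $ i) \<le> - a} \<inter> cbox 0 (- b)"
    by (auto simp: FD_polytope_def mem_box_cart)
  moreover have "closed {\<eta> :: real ^ 'n. (\<Sum>i\<in>UNIV. \<eta> $ i) \<le> - a}"
    by (intro closed_Collect_le continuous_intros)
  ultimately show ?thesis by (metis closed_Int_compact compact_cbox)
qed

lemma convex_FD_polytope: "convex (FD_polytope a b)"
proof -
  have "FD_polytope a b = {\<eta>. 1 \<bullet> \<eta> \<le> - a} \<inter> cbox 0 (- b)"
    by (auto simp: FD_polytope_def mem_box_cart inner_vec_def)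
  then show ?thesis by (simp add: convex_Int convex_halfspace_le)
qed

lemma not_extreme_point_of_symmetric:
  fixes x d :: "'a::euclidean_space"
  assumes "x + d \<in> S" "x - d \<in> S" "d \<noteq> 0"
  shows "\<not> x extreme_point_of S"
proof -
  have "x = midpoint (x + d) (x - d)" by (simp add: midpoint_def flip: scaleR_2)
  moreover have "x + d \<noteq> x - d"
  proof
    assume "x + d = x - d"
    then have "2 *\<^sub>R d = 0" by (simp add: scaleR_2 algebra_simps)
    then show False using assms by simp
  qed
  ultimately have "x \<in> open_segment (x + d) (x - d)"
    by (metis midpoint_in_open_segment)
  then show ?thesis using assms by (auto simp: extreme_point_of_def)
qed

text \<open>
  Near a point with a fractional coordinate one can move inside the polytope in two opposite
  directions. If two coordinates are fractional, mass is shifted between them, which preserves the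
  coordinate sum. If only one is fractional, so is the coordinate sum; the sum constraint is then
  strict and that coordinate moves alone. The bounds on the coordinates are integers and hence
  strict at fractional ones.
\<close>

lemma extreme_point_of_FD_polytope_Ints:
  assumes ext: "\<eta> extreme_point_of FD_polytope (- real N) (- real_vec n)"
  shows "\<eta> $ i \<in> \<int>"
proof (rule ccontr)
  assume i: "\<eta> $ i \<notin> \<int>"
  have P: "(\<Sum>l\<in>UNIV. \<eta> $ l) \<le> N" "\<And>l. 0 \<le> \<eta> $ l" "\<And>l. \<eta> $ l \<le> n $ l"
    using ext by (auto simp: extreme_point_of_def FD_polytope_def real_vec_def)
  have strict: "0 < \<eta> $ l" "\<eta> $ l < n $ l" if "\<eta> $ l \<notin> \<int>" for l
    using P(2,3)[of l] that by (metis Ints_0 less_eq_real_def, metis Ints_of_nat less_eq_real_def)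
  show False
  proof (cases "\<exists>j. j \<noteq> i \<and> \<eta> $ j \<notin> \<int>")
    case True
    then obtain j where j: "j \<noteq> i" "\<eta> $ j \<notin> \<int>" by blast
    define e where "e = Min {\<eta> $ i, n $ i - \<eta> $ i, \<eta> $ j, n $ j - \<eta> $ j}"
    have e: "e > 0" "e \<le> \<eta> $ i" "e \<le> n $ i - \<eta> $ i" "e \<le> \<eta> $ j" "e \<le> n $ j - \<eta> $ j"
      unfolding e_def using strict[OF i] strict[OF j(2)] by auto
    define d where "d = axis i e - axis j e"
    have d: "d $ l = (if l = i then e else if l = j then - e else 0)" for l
      using j by (auto simp: d_def axis_def)
    have sd: "(\<Sum>l\<in>UNIV. d $ l) = 0"
      by (simp add: d_def sum_subtractf axis_def)
    have "\<eta> + d \<in> FD_polytope (- real N) (- real_vec n)"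
      using P e by (auto simp: FD_polytope_def real_vec_def sum.distrib sd) (auto simp: d)
    moreover have "\<eta> - d \<in> FD_polytope (- real N) (- real_vec n)"
      using P e by (auto simp: FD_polytope_def real_vec_def sum_subtractf sd) (auto simp: d)
    moreover have "d \<noteq> 0" using d[of i] e(1) by auto
    ultimately show False using not_extreme_point_of_symmetric ext by blast
  next
    case False
    have "(\<Sum>l\<in>UNIV. \<eta> $ l) \<notin> \<int>"
    proof
      assume s: "(\<Sum>l\<in>UNIV. \<eta> $ l) \<in> \<int>"
      have "(\<Sum>l\<in>UNIV - {i}. \<eta> $ l) \<in> \<int>"
        using False by (intro Ints_sum) auto
      then have "(\<Sum>l\<in>UNIV. \<eta> $ l) - (\<Sum>l\<in>UNIV - {i}. \<eta> $ l) \<in> \<int>"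
        using s Ints_diff by blast
      then show False using i by (simp add: sum.remove[of UNIV i])
    qed
    then have sl: "(\<Sum>l\<in>UNIV. \<eta> $ l) < N"
      using P(1) by (metis Ints_of_nat less_eq_real_def)
    define e where "e = Min {\<eta> $ i, n $ i - \<eta> $ i, N - (\<Sum>l\<in>UNIV. \<eta> $ l)}"
    have e: "e > 0" "e \<le> \<eta> $ i" "e \<le> n $ i - \<eta> $ i" "e \<le> N - (\<Sum>l\<in>UNIV. \<eta> $ l)"
      unfolding e_def using strict[OF i] sl by auto
    define d where "d = axis i e"
    have d: "d $ l = (if l = i then e else 0)" for l
      by (auto simp: d_def axis_def)
    have sd: "(\<Sum>l\<in>UNIV. d $ l) = e"
      by (simp add: d)
    have "\<eta> + d \<in> FD_polytope (- real N) (- real_vec n)"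
      using P e by (auto simp: FD_polytope_def real_vec_def sum.distrib sd) (auto simp: d)
    moreover have "\<eta> - d \<in> FD_polytope (- real N) (- real_vec n)"
      using P e by (auto simp: FD_polytope_def real_vec_def sum_subtractf sd) (auto simp: d)
    moreover have "d \<noteq> 0" using d[of i] e(1) by auto
    ultimately show False using not_extreme_point_of_symmetric ext by blast
  qed
qed

lemma FD_polytope_eq_convex_hull:
  "FD_polytope (- real N) (- real_vec n) = convex hull (real_vec ` lattice_points N n)"
    (is "?P = ?H")
proof
  have "x \<in> real_vec ` lattice_points N n" if ext: "x extreme_point_of ?P" for x
  proof -
    have xP: "x \<in> ?P" using ext by (simp add: extreme_point_of_def)
    have nat: "real (nat \<lfloor>x $ i\<rfloor>) = x $ i" for i
      using extreme_point_of_FD_polytope_Ints[OF ext, of i] xP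
      by (auto simp: FD_polytope_def elim!: Ints_cases)
    have "x = real_vec (\<chi> i. nat \<lfloor>x $ i\<rfloor>)"
      by (simp add: real_vec_def vec_eq_iff nat)
    then show ?thesis using xP real_vec_in_FD_polytope_iff by (metis image_eqI)
  qed
  then show "?P \<subseteq> ?H"
    using Krein_Milman_Minkowski[OF compact_FD_polytope convex_FD_polytope]
    by (metis (no_types, lifting) hull_mono mem_Collect_eq subsetI)
  show "?H \<subseteq> ?P"
    by (intro hull_minimal convex_FD_polytope) (auto simp: real_vec_in_FD_polytope_iff)
qed

section \<open>The Lauricella polynomial in logarithmic coordinates\<close>

definition FD_coeff :: "real \<Rightarrow> real ^ 'n \<Rightarrow> real \<Rightarrow> nat ^ 'n \<Rightarrow> real" where
  "FD_coeff a b c k =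
     (pochhammer a (\<Sum>i\<in>UNIV. k $ i) * (\<Prod>i\<in>UNIV. pochhammer (b $ i) (k $ i))) /
     (pochhammer c (\<Sum>i\<in>UNIV. k $ i) * (\<Prod>i\<in>UNIV. pochhammer 1 (k $ i)))"

lemma signed_pochhammer_pos:
  assumes "k \<le> n"
  shows "(-1) ^ k * pochhammer (- real n) k > 0"
  using assms
proof (induction k)
  case (Suc k)
  have "(-1) ^ Suc k * pochhammer (- real n) (Suc k)
      = ((-1) ^ k * pochhammer (- real n) k) * (real n - real k)"
    by (simp add: pochhammer_Suc algebra_simps)
  also have "\<dots> > 0" using Suc by (intro mult_pos_pos[of "_ * _"]) auto
  finally show ?case .
qed simp

lemma FD_coeff_pos:
  assumes "c > 0" and k: "k \<in> lattice_points N n"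
  shows "FD_coeff (- real N) (- real_vec n) c k > 0"
proof -
  define s where "s = (\<Sum>i\<in>UNIV. k $ i)"
  define A where "A = pochhammer (- real N) s"
  define B where "B = (\<Prod>i\<in>UNIV. pochhammer (- real (n $ i)) (k $ i))"
  have "(-1) ^ s * A > 0"
    unfolding A_def using k by (intro signed_pochhammer_pos) (simp add: lattice_points_def s_def)
  moreover have "(-1) ^ s * B > 0"
  proof -
    have "(-1) ^ s * B = (\<Prod>i\<in>UNIV. (-1) ^ (k $ i) * pochhammer (- real (n $ i)) (k $ i))"
      by (simp add: B_def s_def power_sum prod.distrib)
    also have "\<dots> > 0"
      using k by (intro prod_pos signed_pochhammer_pos) (simp add: lattice_points_def)
    finally show ?thesis .
  qed
  ultimately have "((-1) ^ s * A) * ((-1) ^ s * B) > 0" by (rule mult_pos_pos)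
  also have "((-1) ^ s * A) * ((-1) ^ s * B) = ((-1) ^ s * (-1) ^ s) * (A * B)"
    by (simp add: algebra_simps)
  also have "(-1) ^ s * (-1) ^ s = (1::real)"
    by (simp flip: power_mult_distrib)
  finally have "A * B > 0" by simp
  moreover have "pochhammer c s * (\<Prod>i\<in>UNIV. pochhammer 1 (k $ i)) > 0"
    using \<open>c > 0\<close> by (intro mult_pos_pos prod_pos pochhammer_pos) auto
  ultimately show ?thesis
    by (simp add: FD_coeff_def A_def B_def s_def real_vec_def)
qed

lemma FD_coeff_eq_0:
  assumes "k \<notin> lattice_points N n"
  shows "FD_coeff (- real N) (- real_vec n) c k = 0"
proof (cases "(\<Sum>i\<in>UNIV. k $ i) \<le> N")
  case True
  then obtain i where "k $ i > n $ i"
    using assms by (auto simp: lattice_points_def not_le)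
  then have "(\<Prod>i\<in>UNIV. pochhammer (- real (n $ i)) (k $ i)) = 0"
    by (auto intro!: exI[of _ i] simp: pochhammer_of_nat_eq_0_iff)
  then show ?thesis by (simp add: FD_coeff_def real_vec_def)
qed (simp add: FD_coeff_def pochhammer_of_nat_eq_0_iff)

lemma lauricella_FD_finite_sum:
  "lauricella_FD (- real N) (- real_vec n) c z =
     (\<Sum>k\<in>lattice_points N n. FD_coeff (- real N) (- real_vec n) c k * (\<Prod>i\<in>UNIV. z $ i ^ (k $ i)))"
proof -
  have "lauricella_FD (- real N) (- real_vec n) c z =
     (\<Sum>\<^sub>\<infinity>k\<in>UNIV. FD_coeff (- real N) (- real_vec n) c k * (\<Prod>i\<in>UNIV. z $ i ^ (k $ i)))"
    by (simp add: lauricella_FD_def FD_coeff_def)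
  also have "\<dots> = (\<Sum>\<^sub>\<infinity>k\<in>lattice_points N n.
      FD_coeff (- real N) (- real_vec n) c k * (\<Prod>i\<in>UNIV. z $ i ^ (k $ i)))"
    by (rule infsum_cong_neutral) (auto simp: FD_coeff_eq_0)
  finally show ?thesis by (simp add: finite_lattice_points)
qed

text \<open>
  The operator \<open>z\<^sub>i \<partial>/\<partial>z\<^sub>i\<close> is diagonal on monomials, with eigenvalue \<open>k\<^sub>i\<close> on \<open>z\<^sup>k\<close>; this is what
  puts the exponent vectors into the numerator of the moment map.
\<close>

lemma euler_partial_deriv_polynomial:
  fixes w :: "nat ^ 'n \<Rightarrow> real"
  assumes "\<And>y. f y = (\<Sum>k\<in>K. w k * (\<Prod>j\<in>UNIV. y $ j ^ (k $ j)))"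
  shows "z $ i * partial_deriv i f z = (\<Sum>k\<in>K. w k * (\<Prod>j\<in>UNIV. z $ j ^ (k $ j)) * real (k $ i))"
proof -
  define R where "R k = (\<Prod>j\<in>UNIV - {i}. z $ j ^ (k $ j))" for k :: "nat ^ 'n"
  have split: "(\<Prod>j\<in>UNIV. (if j = i then t else z $ j) ^ (k $ j)) = t ^ (k $ i) * R k" for t k
    unfolding R_def by (subst prod.remove[of _ i]) (auto intro!: prod.cong)
  have "((\<lambda>t. f (\<chi> j. if j = i then t else z $ j)) has_real_derivative
          (\<Sum>k\<in>K. w k * (real (k $ i) * z $ i ^ (k $ i - 1) * R k))) (at (z $ i))"
    unfolding assms
    by (simp add: split) (auto intro!: derivative_eq_intros sum.cong)
  then have "partial_deriv i f z = (\<Sum>k\<in>K. w k * (real (k $ i) * z $ i ^ (k $ i - 1) * R k))"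
    unfolding partial_deriv_def by (rule DERIV_imp_deriv)
  then have "z $ i * partial_deriv i f z
      = (\<Sum>k\<in>K. w k * ((z $ i * z $ i ^ (k $ i - 1) * real (k $ i)) * R k))"
    by (simp add: sum_distrib_left algebra_simps)
  also have "\<dots> = (\<Sum>k\<in>K. w k * (z $ i ^ (k $ i) * R k) * real (k $ i))"
  proof (intro sum.cong refl)
    fix k :: "nat ^ 'n"
    have h: "z $ i * z $ i ^ (k $ i - 1) * real (k $ i) = z $ i ^ (k $ i) * real (k $ i)"
      by (cases "k $ i") auto
    show "w k * ((z $ i * z $ i ^ (k $ i - 1) * real (k $ i)) * R k)
        = w k * (z $ i ^ (k $ i) * R k) * real (k $ i)"
      by (simp only: h) (simp only: mult_ac)
  qed
  also have "\<dots> = (\<Sum>k\<in>K. w k * (\<Prod>j\<in>UNIV. z $ j ^ (k $ j)) * real (k $ i))"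
    by (simp add: R_def prod.remove[of UNIV i])
  finally show ?thesis .
qed

lemma FD_map_exp:
  "FD_map (- real N) (- real_vec n) c (\<chi> i. exp (x $ i)) =
     moment_map (lattice_points N n) (FD_coeff (- real N) (- real_vec n) c) real_vec x"
proof -
  have mono: "(\<Prod>i\<in>UNIV. exp (x $ i) ^ (k $ i)) = exp (real_vec k \<bullet> x)" for k
    by (simp add: real_vec_def inner_vec_def exp_sum exp_of_nat_mult)
  show ?thesis
    unfolding FD_map_def moment_map_def vec_eq_iff
    by (simp only: vec_lambda_beta euler_partial_deriv_polynomial[OF lauricella_FD_finite_sum, of "\<chi> i. exp (x $ i)", simplified vec_lambda_beta] lauricella_FD_finite_sum)
       (simp add: mono real_vec_def divide_inverse_commute)
qed

lemma positive_orthant_eq_range_exp: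
  "{z :: real ^ 'n. \<forall>i. z $ i > 0} = range (\<lambda>x. \<chi> i. exp (x $ i))"
proof -
  have "z = (\<chi> i. exp ((\<chi> i. ln (z $ i)) $ i))" if "\<forall>i. z $ i > 0" for z :: "real ^ 'n"
    using that by (simp add: vec_eq_iff)
  then show ?thesis by fastforce
qed

lemma inj_exp_vec: "inj (\<lambda>x :: real ^ 'n. \<chi> i. exp (x $ i))"
  by (auto simp: inj_on_def vec_eq_iff)

section \<open>Injectivity on the positive orthant\<close>

lemma inj_moment_map_lattice_points_iff:
  fixes n :: "nat ^ 'n"
  assumes w: "\<And>k. k \<in> lattice_points N n \<Longrightarrow> w k > 0"
  shows "inj (moment_map (lattice_points N n) w real_vec) \<longleftrightarrow> N \<noteq> 0 \<and> (\<forall>i. n $ i \<noteq> 0)"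
proof
  assume nz: "N \<noteq> 0 \<and> (\<forall>i. n $ i \<noteq> 0)"
  show "inj (moment_map (lattice_points N n) w real_vec)"
  proof (rule injI)
    fix x y :: "real ^ 'n"
    assume eq: "moment_map (lattice_points N n) w real_vec x = moment_map (lattice_points N n) w real_vec y"
    have "x $ i = y $ i" for i
    proof -
      have "axis i 1 \<in> lattice_points N n" "0 \<in> lattice_points N n"
        using nz by (auto simp: lattice_points_def axis_def Suc_le_eq)
      from moment_map_eqD[OF finite_lattice_points w eq this]
      show ?thesis
        by (simp add: real_vec_def inner_vec_def axis_def if_distrib if_distribR cong: if_cong)
    qed
    then show "x = y" by (simp add: vec_eq_iff)
  qed
next
  assume inj: "inj (moment_map (lattice_points N n) w real_vec)"
  show "N \<noteq> 0 \<and> (\<forall>i. n $ i \<noteq> 0)"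
  proof (rule ccontr)
    assume "\<not> ?thesis"
    then obtain i where i: "N = 0 \<or> n $ i = 0" by auto
    have "k $ i = 0" if k: "k \<in> lattice_points N n" for k
      using i
    proof
      assume "N = 0"
      then show ?thesis using k by (simp add: lattice_points_def)
    next
      assume "n $ i = 0"
      then show ?thesis using k by (auto simp: lattice_points_def dest: spec[of _ i])
    qed
    then have "real_vec k \<bullet> axis i 1 = 0" if "k \<in> lattice_points N n" for k
      using that by (simp add: inner_axis real_vec_def)
    then have "moment_map (lattice_points N n) w real_vec (axis i 1)
        = moment_map (lattice_points N n) w real_vec 0"
      by (simp add: moment_map_def cong: sum.cong)
    then have "axis i 1 = (0 :: real ^ 'n)" using inj by (simp add: inj_eq)
    then show False by (simp add: axis_eq_0_iff)
  qed
qed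

theorem theorem2:
  fixes a c :: real and b :: "real ^ 'n"
  assumes "a \<in> \<int>\<^sub>\<le>\<^sub>0"
    and "\<forall>i. b $ i \<in> \<int>\<^sub>\<le>\<^sub>0"
    and "c \<in> \<int>" and "c > 0"
  shows "FD_map a b c ` {z. \<forall>i. z $ i > 0} = rel_interior (FD_polytope a b)
    \<and> (inj_on (FD_map a b c) {z. \<forall>i. z $ i > 0} \<longleftrightarrow> a \<noteq> 0 \<and> (\<forall>i. b $ i \<noteq> 0))"
proof -
  obtain N where N: "a = - real N"
    using assms(1) by (auto elim: nonpos_Ints_cases')
  have "\<forall>i. \<exists>m. b $ i = - real m"
    using assms(2) by (metis nonpos_Ints_cases')
  then obtain m where m: "\<And>i. b $ i = - real (m i)" by metis
  define n :: "nat ^ 'n" where "n = (\<chi> i. m i)"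
  have b: "b = - real_vec n" by (simp add: vec_eq_iff m n_def real_vec_def)
  let ?w = "FD_coeff (- real N) (- real_vec n) c"
  let ?K = "lattice_points N n"
  let ?E = "\<lambda>x :: real ^ 'n. \<chi> i. exp (x $ i)"
  have comp: "FD_map a b c \<circ> ?E = moment_map ?K ?w real_vec"
    by (simp add: fun_eq_iff N b FD_map_exp)
  have w: "?w k > 0" if "k \<in> ?K" for k using FD_coeff_pos assms(4) that by blast
  have ne: "?K \<noteq> {}" by (auto simp: lattice_points_def intro!: exI[of _ 0])
  have "FD_map a b c ` range ?E = range (moment_map ?K ?w real_vec)"
    by (simp only: image_comp comp)
  also have "\<dots> = rel_interior (FD_polytope a b)"
    using range_moment_map[OF finite_lattice_points ne w, where p = real_vec]
    by (simp add: N b FD_polytope_eq_convex_hull)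
  finally have "FD_map a b c ` range ?E = rel_interior (FD_polytope a b)" .
  moreover have "inj_on (FD_map a b c) (range ?E) \<longleftrightarrow> inj (moment_map ?K ?w real_vec)"
    using comp_inj_on_iff[OF inj_exp_vec, of "FD_map a b c"] by (simp add: comp)
  moreover have "\<dots> \<longleftrightarrow> a \<noteq> 0 \<and> (\<forall>i. b $ i \<noteq> 0)"
    using inj_moment_map_lattice_points_iff[OF w] by (simp add: N b real_vec_def)
  ultimately show ?thesis unfolding positive_orthant_eq_range_exp by simp
qed

end
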